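(* If $n\geq 7$ is an odd integer, then there exists a transmission irregular chemical tree of order $n$.
   Context: All graphs are finite, simple and connected. The order $n(G)$ of a graph $G$ is its number of vertices. For a vertex $x$ of $G$, the transmission of $x$ is $\mathrm{Tr}_G(x)=\sum_{u\in V(G)\setminus\{x\}}d_G(x,u)$, where $d_G$ is the shortest-path distance. The graph $G$ is transmission irregular if any two distinct vertices have different transmissions, i.e. $|\{\mathrm{Tr}_G(x): x\in V(G)\}|=n(G)$. A graph is a chemical graph if its maximum degree is at most $4$; a chemical tree is a tree that is a chemical graph. *)

theory Defs
  imports "Graph_Theory.Graph_Theory"
begin

text \<open>
  A finite simple graph is a \<^locale>\<open>pair_graph\<close>: a finite, loop-free, symmetric digraph whose
  arcs are pairs of vertices. An undirected edge is represented by its two opposite arcs.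
\<close>

definition simple_connected_graph :: "'a pair_pre_digraph \<Rightarrow> bool" where
  "simple_connected_graph G \<longleftrightarrow> pair_graph G \<and> Digraph_Component.connected (with_proj G)"

text \<open>
  The predicate \<^const>\<open>tree\<close> of the library is about directed cycles, so the two opposite arcs of
  an edge already form a cycle for it and no symmetric digraph with an edge satisfies it. The cycles
  of an undirected simple graph are the closed walks without repeated vertices of length at least 3.
\<close>

definition simple_tree :: "'a pair_pre_digraph \<Rightarrow> bool" where
  "simple_tree G \<longleftrightarrow> simple_connected_graph G
     \<and> \<not> (\<exists>p. pre_digraph.cycle (with_proj G) p \<and> 3 \<le> length p)"

text \<open>As the arcs come in opposite pairs, the out-degree is the number of neighbours.\<close>

definition max_degree :: "'a pair_pre_digraph \<Rightarrow> nat" where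
  "max_degree G = Max (out_degree (with_proj G) ` pverts G)"

definition chemical_graph :: "'a pair_pre_digraph \<Rightarrow> bool" where
  "chemical_graph G \<longleftrightarrow> simple_connected_graph G \<and> max_degree G \<le> 4"

definition chemical_tree :: "'a pair_pre_digraph \<Rightarrow> bool" where
  "chemical_tree G \<longleftrightarrow> simple_tree G \<and> chemical_graph G"

definition graph_order :: "'a pair_pre_digraph \<Rightarrow> nat" where
  "graph_order G = card (pverts G)"

text \<open>The minimal number of edges of a walk; only meaningful if a walk exists.\<close>

definition graph_dist :: "'a pair_pre_digraph \<Rightarrow> 'a \<Rightarrow> 'a \<Rightarrow> nat" where
  "graph_dist G u v = (LEAST k. \<exists>p. pre_digraph.awalk (with_proj G) u p v \<and> length p = k)"

definition transmission :: "'a pair_pre_digraph \<Rightarrow> 'a \<Rightarrow> nat" where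
  "transmission G x = (\<Sum>u \<in> pverts G - {x}. graph_dist G x u)"

definition transmission_irregular :: "'a pair_pre_digraph \<Rightarrow> bool" where
  "transmission_irregular G \<longleftrightarrow>
     (\<forall>x \<in> pverts G. \<forall>y \<in> pverts G. x \<noteq> y \<longrightarrow> transmission G x \<noteq> transmission G y)"

lemma transmission_irregular_iff_card:
  assumes "pair_graph G"
  shows "transmission_irregular G \<longleftrightarrow> card (transmission G ` pverts G) = graph_order G"
proof -
  interpret pair_graph G by (rule assms)
  have "transmission_irregular G \<longleftrightarrow> inj_on (transmission G) (pverts G)"
    unfolding transmission_irregular_def inj_on_def by blast
  also have "\<dots> \<longleftrightarrow> card (transmission G ` pverts G) = graph_order G"
    unfolding graph_order_def using pair_finite_verts by (metis card_image eq_card_imp_inj_on)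
  finally show ?thesis .
qed

text \<open>The distance is the library's shortest-path cost for unit arc weights.\<close>

lemma (in pair_wf_digraph) graph_dist_eq_shortest_path:
  assumes "u \<rightarrow>\<^sup>*\<^bsub>with_proj G\<^esub> v"
  shows "\<mu> (\<lambda>_. 1) u v = ereal (real (graph_dist G u v))"
proof -
  have cost: "awalk_cost (\<lambda>_. 1) p = real (length p)" for p
    by (induct p) auto
  let ?P = "\<lambda>k. \<exists>p. awalk u p v \<and> length p = k"
  have "\<exists>k. ?P k" using assms by (auto simp: reachable_awalk)
  then have "?P (graph_dist G u v)" unfolding graph_dist_def by (rule LeastI_ex)
  then obtain p where p: "awalk u p v" "length p = graph_dist G u v" by blast
  have le: "graph_dist G u v \<le> length q" if "awalk u q v" for q
    unfolding graph_dist_def by (rule Least_le) (use that in blast)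
  show ?thesis
    unfolding \<mu>_def
  proof (rule INF_eqI)
    fix q assume "q \<in> {p. awalk u p v}"
    then show "ereal (real (graph_dist G u v)) \<le> ereal (awalk_cost (\<lambda>_. 1) q)"
      using le by (simp add: cost)
  next
    fix y assume "\<And>q. q \<in> {p. awalk u p v} \<Longrightarrow> y \<le> ereal (awalk_cost (\<lambda>_. 1) q)"
    from this[of p] show "y \<le> ereal (real (graph_dist G u v))"
      using p by (simp add: cost)
  qed
qed

end

theory Submission
  imports Defs
begin

text \<open>
  Every edge \<open>uv\<close> of a tree is a bridge, and stepping across it brings one component closer by one
  and the other one farther away by one. Hence \<open>Tr v = Tr u + n - 2 * card S\<close>, where \<open>S\<close> is the
  component of \<open>v\<close> after removal of \<open>uv\<close> (\<open>transmission_bridge\<close>). For odd \<open>n\<close> the increments along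
  a long bare arm of the tree, walked outwards, are consecutive odd numbers, so up to constants the
  transmissions on an arm are consecutive squares.

  The tree is a path on \<open>n - 2\<close> vertices with two further leaves, attached to path vertices
  \<open>2 * k\<close> and \<open>2 * k + 2\<close>, where \<open>k = n div 4\<close>. Write \<open>n = 4 * k + 1 + 2 * e\<close> with \<open>e \<in> {0, 1}\<close>
  and measure transmissions relative to vertex \<open>2 * k\<close>. They are then as follows.

    \<^item> On the left arm, up to and including \<open>2 * k\<close>, they are \<open>a\<^sup>2 - e\<close>.
    \<^item> On the right arm, from \<open>2 * k + 2\<close> on, they are \<open>b\<^sup>2 - 8 + 3 * e\<close>.
    \<^item> At \<open>2 * k + 1\<close> and at the two attached leaves, they are \<open>3 - 2 * e\<close>, \<open>n - 2\<close> and
      \<open>n + 6 - 4 * e\<close>.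

  Adding \<open>e\<close> makes the values on both arms congruent to a square, hence to 0 or 1, modulo 4, while
  the three exceptional values become congruent to 2 or 3. So an exceptional vertex never collides
  with an arm, whatever the size of \<open>n\<close> (\<open>comb_offset_mod_4\<close>). A collision between the two arms
  would require squares differing by exactly 8 or 4, which happens only for numbers smaller than
  those that occur (\<open>squares_with_gap_below_9\<close>).

  The second leaf is what makes the residues work: with a single leaf attached to a middle vertex of
  a path on \<open>n - 1\<close> vertices, the arms carry \<open>a\<^sup>2\<close> and \<open>b\<^sup>2 - 1\<close> and the leaf carries \<open>n - 2\<close>, which
  collide for infinitely many odd \<open>n\<close>.
\<close>

section \<open>Bridges\<close>

text \<open>
  The edge \<open>uv\<close> is a bridge and \<open>S\<close> is a side of it that contains \<open>v\<close>. Only the arcs entering \<open>S\<close>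
  are constrained; in a symmetric graph this controls the leaving arcs as well.
\<close>

definition bridge_side :: "'a pair_pre_digraph \<Rightarrow> 'a \<Rightarrow> 'a \<Rightarrow> 'a set \<Rightarrow> bool" where
  "bridge_side G u v S \<longleftrightarrow> (u, v) \<in> parcs G \<and> S \<subseteq> pverts G \<and> u \<notin> S \<and> v \<in> S
     \<and> (\<forall>x y. (x, y) \<in> parcs G \<and> x \<notin> S \<and> y \<in> S \<longrightarrow> x = u \<and> y = v)"

lemma (in pair_graph) bridge_side_compl:
  assumes "bridge_side G u v S"
  shows "bridge_side G v u (pverts G - S)"
  using assms arcs_symmetric[of u v] unfolding bridge_side_def
  by (auto dest: in_arcsD1 in_arcsD2 arcs_symmetric)

lemma (in pair_graph) walk_crosses_bridge:
  assumes "bridge_side G u v S" "awalk x p y" "x \<notin> S" "y \<in> S"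
  obtains p1 p2 where "p = p1 @ (u, v) # p2" "awalk v p2 y"
  using assms(2,3)
proof (induct p arbitrary: x thesis)
  case Nil
  then show ?case using assms(4) by (auto simp: awalk_simps)
next
  case (Cons e p)
  then have e: "e \<in> parcs G" "x = fst e" "awalk (snd e) p y"
    by (auto simp: awalk_simps)
  show ?case
  proof (cases "snd e \<in> S")
    case True
    then have "e = (u, v)" using assms(1) e Cons.prems(3)
      unfolding bridge_side_def by (cases e) auto
    then show ?thesis using Cons.prems(1)[of "[]" p] e by auto
  next
    case False
    then obtain p1 p2 where "p = p1 @ (u, v) # p2" "awalk v p2 y"
      using Cons.hyps e(3) by blast
    then show ?thesis using Cons.prems(1)[of "e # p1" p2] by auto
  qed
qed

text \<open>
  A cycle that starts along a bridge \<open>(u, v)\<close> has to come back along \<open>(v, u)\<close>. As no vertex is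
  repeated, it can contain no further arc.
\<close>

lemma (in pair_graph) no_long_cycle_if_bridges:
  assumes "\<And>u v. (u, v) \<in> parcs G \<Longrightarrow> \<exists>S. bridge_side G u v S"
  shows "\<not> (\<exists>p. cycle p \<and> 3 \<le> length p)"
proof
  assume "\<exists>p. cycle p \<and> 3 \<le> length p"
  then obtain u p where p: "awalk u p u" "distinct (tl (awalk_verts u p))" "3 \<le> length p"
    unfolding cycle_def by blast
  then obtain e r where r: "p = e # r" by (cases p) auto
  with p have e: "e \<in> parcs G" "u = fst e" and walk: "awalk (snd e) r u"
    and dist: "distinct (awalk_verts (snd e) r)"
    by (auto simp: awalk_simps)
  obtain v where [simp]: "e = (u, v)" using e by (cases e) auto
  obtain S where S: "bridge_side G u v S" using assms[of u v] e(1) by auto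
  have "v \<notin> pverts G - S" "u \<in> pverts G - S"
    using S in_arcsD1 unfolding bridge_side_def by auto
  from walk_crosses_bridge[OF bridge_side_compl[OF S] _ this(1) this(2)] walk
  obtain r1 r2 where rr: "r = r1 @ (v, u) # r2" "awalk u r2 u" by auto
  have len: "length r1 + length r2 \<ge> 1" using p r rr by auto
  have w1: "awalk v r1 v" using walk rr(1) by (auto simp: awalk_simps)
  \<comment> \<open>Otherwise \<open>v\<close> occurs both at the start of \<open>r1\<close> and at its end, where \<open>(v, u)\<close> leaves.\<close>
  have "r1 = []"
  proof (cases r1)
    case (Cons a as)
    have "awalk_verts v r = butlast (awalk_verts v r1) @ awalk_verts v ((v, u) # r2)"
      using walk rr(1) w1 by (simp add: awalk_verts_conv butlast_append)
    moreover have "v \<in> set (butlast (awalk_verts v r1))"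
      using w1 Cons by (auto simp: awalk_simps awalk_verts_conv)
    ultimately show ?thesis using dist by auto
  qed simp
  \<comment> \<open>Otherwise \<open>u\<close> occurs both at the start of \<open>r2\<close> and at the end of the closed walk.\<close>
  moreover have "r2 = []"
  proof (cases r2)
    case (Cons a as)
    then have "awalk_verts u r2 = u # awalk_verts (snd a) as" "awalk (snd a) as u"
      using rr(2) by (auto simp: awalk_simps)
    moreover have "u \<in> set (awalk_verts (snd a) as)"
      using calculation(2) by (metis awlast_of_awalk awalk_verts_non_Nil last_in_set awalkE')
    ultimately show ?thesis using dist rr(1) \<open>r1 = []\<close> by auto
  qed simp
  ultimately show False using len by simp
qed

section \<open>Distances and transmissions across a bridge\<close>

lemma (in pair_graph) graph_dist_le:
  assumes "awalk u p v"
  shows "graph_dist G u v \<le> length p"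
  unfolding graph_dist_def by (rule Least_le) (use assms in blast)

lemma (in pair_graph) shortest_walk:
  assumes "Digraph_Component.connected (with_proj G)" "u \<in> pverts G" "v \<in> pverts G"
  obtains p where "awalk u p v" "length p = graph_dist G u v"
proof -
  have "strongly_connected (with_proj G)"
    using symmetric_connected_imp_strongly_connected[OF sym_arcs assms(1)] .
  then obtain p where "awalk u p v"
    using assms(2,3) strongly_connectedE reachable_awalk with_proj_simps(1) by metis
  then have "\<exists>k p. awalk u p v \<and> length p = k" by blast
  from LeastI_ex[OF this] that show ?thesis unfolding graph_dist_def by blast
qed

text \<open>
  A shortest walk from \<open>u\<close> into the side of \<open>v\<close> must use the arc \<open>(u, v)\<close>, and what follows that arc
  is a walk from \<open>v\<close>.
\<close>

lemma (in pair_graph) graph_dist_bridge: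
  assumes "Digraph_Component.connected (with_proj G)" "bridge_side G u v S" "y \<in> S"
  shows "graph_dist G u y = graph_dist G v y + 1"
proof -
  have in_G: "u \<in> pverts G" "v \<in> pverts G" "y \<in> pverts G" and arc: "(u, v) \<in> parcs G"
    and "u \<notin> S"
    using assms in_arcsD1 unfolding bridge_side_def by auto
  obtain p where p: "awalk v p y" "length p = graph_dist G v y"
    using shortest_walk[OF assms(1)] in_G by metis
  then have "awalk u ((u, v) # p) y" using arc by (auto simp: awalk_simps)
  from graph_dist_le[OF this] have le: "graph_dist G u y \<le> graph_dist G v y + 1"
    using p by simp
  obtain q where q: "awalk u q y" "length q = graph_dist G u y"
    using shortest_walk[OF assms(1)] in_G by metis
  obtain q1 q2 where "q = q1 @ (u, v) # q2" "awalk v q2 y"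
    using walk_crosses_bridge[OF assms(2) q(1) \<open>u \<notin> S\<close> assms(3)] .
  with graph_dist_le[of v q2 y] q le show ?thesis by simp
qed

lemma (in pair_graph) transmission_eq_sum:
  assumes "x \<in> pverts G"
  shows "transmission G x = (\<Sum>u \<in> pverts G. graph_dist G x u)"
proof -
  have "awalk x [] x" using assms by (simp add: awalk_simps)
  from graph_dist_le[OF this] have "graph_dist G x x = 0" by simp
  then show ?thesis
    unfolding transmission_def using assms pair_finite_verts by (simp add: sum.remove)
qed

text \<open>
  Passing from \<open>u\<close> to \<open>v\<close> decreases the distance to each vertex of \<open>S\<close> by one and increases the
  distance to each other vertex by one.
\<close>

lemma (in pair_graph) transmission_bridge:
  assumes "Digraph_Component.connected (with_proj G)" "bridge_side G u v S"
  shows "int (transmission G v) = int (transmission G u) + int (graph_order G) - 2 * int (card S)"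
proof -
  have in_G: "u \<in> pverts G" "v \<in> pverts G" "S \<subseteq> pverts G"
    using assms in_arcsD1 unfolding bridge_side_def by auto
  have fin: "finite (pverts G)" "finite S"
    using pair_finite_verts finite_subset[OF in_G(3)] by blast+
  let ?d = "\<lambda>y. int (graph_dist G v y) - int (graph_dist G u y)"
  have "int (transmission G v) - int (transmission G u) = (\<Sum>y \<in> pverts G. ?d y)"
    using in_G by (simp add: transmission_eq_sum sum_subtractf)
  also have "\<dots> = (\<Sum>y \<in> pverts G - S. ?d y) + (\<Sum>y \<in> S. ?d y)"
    by (rule sum.subset_diff[OF in_G(3) fin(1)])
  also have "(\<Sum>y \<in> pverts G - S. ?d y) = (\<Sum>y \<in> pverts G - S. 1)"
    using graph_dist_bridge[OF assms(1) bridge_side_compl[OF assms(2)]]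
    by (intro sum.cong) auto
  also have "(\<Sum>y \<in> S. ?d y) = (\<Sum>y \<in> S. - 1)"
    using graph_dist_bridge[OF assms] by (intro sum.cong) auto
  also have "(\<Sum>y \<in> pverts G - S. 1) = int (card (pverts G)) - int (card S)"
    using in_G fin by (simp add: card_Diff_subset card_mono of_nat_diff)
  finally show ?thesis unfolding graph_order_def by simp
qed

section \<open>Trees given by a parent function\<close>

definition parent_tree :: "nat \<Rightarrow> (nat \<Rightarrow> nat) \<Rightarrow> nat pair_pre_digraph" where
  "parent_tree n par = \<lparr> pverts = {..<n},
     parcs = {(x, y). x < n \<and> y < n \<and> (0 < x \<and> y = par x \<or> 0 < y \<and> x = par y)} \<rparr>"

text \<open>
  The set of descendants of \<open>v\<close>, by closure properties instead of iterated parents, so that an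
  explicitly given set can be checked vertex by vertex.
\<close>

definition branch :: "nat \<Rightarrow> (nat \<Rightarrow> nat) \<Rightarrow> nat \<Rightarrow> nat set \<Rightarrow> bool" where
  "branch n par v S \<longleftrightarrow> S \<subseteq> {..<n} \<and> v \<in> S \<and> par v \<notin> S
     \<and> (\<forall>w. 0 < w \<and> w < n \<and> w \<noteq> v \<longrightarrow> (w \<in> S \<longleftrightarrow> par w \<in> S))"

lemma pverts_parent_tree [simp]: "pverts (parent_tree n par) = {..<n}"
  by (simp add: parent_tree_def)

context
  fixes n :: nat and par :: "nat \<Rightarrow> nat"
  assumes par_less: "\<And>v. 0 < v \<Longrightarrow> v < n \<Longrightarrow> par v < v"
begin

lemma arc_parent_tree_iff:
  "(x, y) \<in> parcs (parent_tree n par) \<longleftrightarrow>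
     0 < x \<and> x < n \<and> y = par x \<or> 0 < y \<and> y < n \<and> x = par y"
  using par_less[of x] par_less[of y] by (auto simp: parent_tree_def)

lemma pair_graph_parent_tree: "pair_graph (parent_tree n par)"
proof
  fix e assume e: "e \<in> parcs (parent_tree n par)"
  then show "fst e \<in> pverts (parent_tree n par)" "snd e \<in> pverts (parent_tree n par)"
    by (auto simp: parent_tree_def)
  obtain x y where [simp]: "e = (x, y)" by (cases e)
  show "fst e \<noteq> snd e"
    using e par_less[of x] par_less[of y] by (auto simp: arc_parent_tree_iff)
next
  show "finite (parcs (parent_tree n par))"
    by (rule finite_subset[of _ "{..<n} \<times> {..<n}"]) (auto simp: parent_tree_def)
  show "symmetric (with_proj (parent_tree n par))"
    unfolding symmetric_def by (rule symI) (auto simp: arc_parent_tree_iff)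
qed simp

lemma connected_parent_tree:
  assumes "0 < n"
  shows "Digraph_Component.connected (with_proj (parent_tree n par))"
proof -
  interpret pair_graph "parent_tree n par" by (rule pair_graph_parent_tree)
  have reach: "v < n \<Longrightarrow> v \<rightarrow>\<^sup>*\<^bsub>with_proj (parent_tree n par)\<^esub> 0" for v
  proof (induct v rule: less_induct)
    case (less v)
    show ?case
    proof (cases "v = 0")
      case True
      then show ?thesis using assms by simp
    next
      case False
      then have "par v < v" "(v, par v) \<in> parcs (parent_tree n par)"
        using par_less less.prems by (auto simp: arc_parent_tree_iff)
      then show ?thesis using less by (meson adj_reachable_trans less_trans with_proj_simps(3))
    qed
  qed
  show ?thesis
  proof (rule connectedI)
    fix u v
    assume "u \<in> pverts (parent_tree n par)" "v \<in> pverts (parent_tree n par)"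
    then have "u \<rightarrow>\<^sup>*\<^bsub>with_proj (parent_tree n par)\<^esub> v"
      using reachable_trans[OF reach symmetric_reachable[OF sym_arcs reach]] by simp
    then show "u \<rightarrow>\<^sup>*\<^bsub>mk_symmetric (with_proj (parent_tree n par))\<^esub> v"
      by (rule reachable_mk_symmetricI)
  qed (use assms in \<open>simp add: lessThan_empty_iff\<close>)
qed

lemma bridge_side_branch:
  assumes "0 < v" "v < n" "branch n par v S"
  shows "bridge_side (parent_tree n par) (par v) v S"
  unfolding bridge_side_def using assms
  by (auto simp: arc_parent_tree_iff branch_def)

text \<open>
  The descendants of \<open>v\<close> are the vertices from which \<open>v\<close> is reached by repeatedly taking parents.
  Parents are smaller, so \<open>par v\<close> is not among them.
\<close>

lemma branch_exists:
  assumes "0 < v" "v < n"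
  shows "\<exists>S. branch n par v S"
proof -
  define R where "R = {(w, par w) | w. 0 < w \<and> w < n}"
  have desc_ge: "v \<le> x" if "(x, v) \<in> R\<^sup>*" for x
    using that
  proof (induct rule: converse_rtrancl_induct)
    case (step w x)
    then show ?case using par_less[of w] by (auto simp: R_def)
  qed simp
  have "(w, v) \<in> R\<^sup>* \<longleftrightarrow> (par w, v) \<in> R\<^sup>*" if w: "0 < w" "w < n" "w \<noteq> v" for w
  proof
    assume "(w, v) \<in> R\<^sup>*"
    then show "(par w, v) \<in> R\<^sup>*"
      by (cases rule: converse_rtranclE) (use w in \<open>auto simp: R_def\<close>)
  next
    have "(w, par w) \<in> R" using w by (auto simp: R_def)
    then show "(par w, v) \<in> R\<^sup>* \<Longrightarrow> (w, v) \<in> R\<^sup>*" by (rule converse_rtrancl_into_rtrancl)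
  qed
  moreover have "par w < n" if "0 < w" "w < n" for w using par_less[OF that] that by simp
  moreover have "(par v, v) \<notin> R\<^sup>*" using desc_ge par_less[OF assms] by force
  ultimately have "branch n par v {y. y < n \<and> (y, v) \<in> R\<^sup>*}"
    using assms by (auto simp: branch_def)
  then show ?thesis ..
qed

lemma simple_tree_parent_tree:
  assumes "0 < n"
  shows "simple_tree (parent_tree n par)"
proof -
  interpret pair_graph "parent_tree n par" by (rule pair_graph_parent_tree)
  have down: "\<exists>S. bridge_side (parent_tree n par) (par v) v S" if "0 < v" "v < n" for v
    using branch_exists bridge_side_branch that by blast
  have "\<exists>S. bridge_side (parent_tree n par) u v S"
    if arc: "(u, v) \<in> parcs (parent_tree n par)" for u v
  proof -
    consider "0 < u" "u < n" "v = par u" | "0 < v" "v < n" "u = par v"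
      using arc unfolding arc_parent_tree_iff by blast
    then show ?thesis
    proof cases
      case 1
      then obtain S where "bridge_side (parent_tree n par) v u S" using down[of u] by blast
      from bridge_side_compl[OF this] show ?thesis ..
    next
      case 2
      then show ?thesis using down[of v] by simp
    qed
  qed
  from no_long_cycle_if_bridges[OF this] show ?thesis
    unfolding simple_tree_def simple_connected_graph_def
    using pair_graph_parent_tree connected_parent_tree[OF assms] by (intro conjI)
qed

lemma transmission_parent_tree:
  assumes "0 < v" "v < n" "branch n par v S"
  shows "int (transmission (parent_tree n par) v)
    = int (transmission (parent_tree n par) (par v)) + int n - 2 * int (card S)"
proof -
  interpret pair_graph "parent_tree n par" by (rule pair_graph_parent_tree)
  show ?thesis
    using transmission_bridge[OF connected_parent_tree bridge_side_branch[OF assms]] assms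
    by (simp add: graph_order_def)
qed

end

section \<open>A path with two pendant vertices\<close>

text \<open>
  The path is \<open>0, \<dots>, n - 3\<close>; the last two labels are leaves attached to \<open>p\<close> and \<open>p + 2\<close>. The bound
  \<open>p + 5 \<le> n\<close> used below says that \<open>p + 2\<close> still lies on the path.
\<close>

definition comb_parent :: "nat \<Rightarrow> nat \<Rightarrow> nat \<Rightarrow> nat" where
  "comb_parent n p v = (if v = n - 2 then p else if v = n - 1 then p + 2 else v - 1)"

definition comb :: "nat \<Rightarrow> nat \<Rightarrow> nat pair_pre_digraph" where
  "comb n p = parent_tree n (comb_parent n p)"

context
  fixes n p :: nat
  assumes p_bound: "p + 5 \<le> n"
begin

lemma comb_parent_less: "0 < v \<Longrightarrow> v < n \<Longrightarrow> comb_parent n p v < v"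
  using p_bound by (auto simp: comb_parent_def)

lemma arcs_comb:
  "(x, y) \<in> parcs (comb n p) \<longleftrightarrow>
     0 < x \<and> x < n \<and> y = comb_parent n p x \<or> 0 < y \<and> y < n \<and> x = comb_parent n p y"
  unfolding comb_def by (rule arc_parent_tree_iff[OF comb_parent_less])

lemma transmission_comb_branch:
  assumes "0 < v" "v < n" "branch n (comb_parent n p) v S"
  shows "int (transmission (comb n p) v)
    = int (transmission (comb n p) (comb_parent n p v)) + int n - 2 * int (card S)"
  unfolding comb_def by (rule transmission_parent_tree[OF comb_parent_less assms])

lemma chemical_tree_comb: "chemical_tree (comb n p)"
proof -
  interpret pair_graph "comb n p"
    unfolding comb_def by (rule pair_graph_parent_tree[OF comb_parent_less])
  have tree: "simple_tree (comb n p)"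
    unfolding comb_def using p_bound simple_tree_parent_tree[OF comb_parent_less] by simp
  have "out_degree (with_proj (comb n p)) x \<le> 4" for x
  proof -
    let ?N = "if x = n - 2 then [p] else if x = n - 1 then [p + 2]
      else [x - 1, x + 1, n - 2, n - 1]"
    have "y \<in> set ?N" if "(x, y) \<in> parcs (comb n p)" for y
    proof -
      consider "0 < x" "x < n" "y = comb_parent n p x" | "0 < y" "y < n" "x = comb_parent n p y"
        using \<open>(x, y) \<in> parcs (comb n p)\<close> arcs_comb by blast
      then show ?thesis
      proof cases
        case 1
        then show ?thesis by (simp add: comb_parent_def)
      next
        case 2
        have "comb_parent n p y < n - 2"
          using 2(1,2) p_bound unfolding comb_parent_def by (simp split: if_split) linarith
        moreover have "y = n - 2 \<or> y = n - 1 \<or> y = comb_parent n p y + 1"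
          using 2 by (simp add: comb_parent_def)
        ultimately show ?thesis using 2 by auto
      qed
    qed
    then have "out_arcs (with_proj (comb n p)) x \<subseteq> Pair x ` set ?N"
      unfolding out_arcs_def by (simp only: with_proj_simps) force
    then have "out_degree (with_proj (comb n p)) x \<le> card (Pair x ` set ?N)"
      unfolding out_degree_def by (intro card_mono finite_imageI finite_set)
    also have "\<dots> \<le> card (set ?N)" by (intro card_image_le finite_set)
    also have "\<dots> \<le> length ?N" by (rule card_length)
    also have "\<dots> \<le> 4" by simp
    finally show ?thesis .
  qed
  then have "max_degree (comb n p) \<le> 4"
    unfolding max_degree_def using p_bound by (subst Max_le_iff) (auto simp: comb_def lessThan_empty_iff)
  then show ?thesis
    using tree unfolding chemical_tree_def chemical_graph_def simple_tree_def by blast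
qed

text \<open>
  The branch at a path vertex \<open>v\<close> consists of the rest of the path, which is \<open>n - 2 - v\<close> vertices,
  together with those attached leaves whose neighbour lies on it.
\<close>

lemma transmission_comb_path:
  assumes "0 < v" "v < n - 2"
  shows "int (transmission (comb n p) v) = int (transmission (comb n p) (v - 1))
    + 2 * int v + 4 - int n - (if v \<le> p then 2 else 0) - (if v \<le> p + 2 then 2 else 0)"
proof -
  let ?L = "(if v \<le> p then {n - 2} else {}) \<union> (if v \<le> p + 2 then {n - 1} else {})"
  have "branch n (comb_parent n p) v ({v..<n - 2} \<union> ?L)"
    unfolding branch_def
  proof (intro conjI allI impI)
    fix w
    assume w: "0 < w \<and> w < n \<and> w \<noteq> v"
    then consider "w < n - 2" | "w = n - 2" | "w = n - 1" by linarith
    then show "w \<in> {v..<n - 2} \<union> ?L \<longleftrightarrow> comb_parent n p w \<in> {v..<n - 2} \<union> ?L"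
      by cases (use w p_bound assms in \<open>auto simp: comb_parent_def\<close>)
  qed (use assms p_bound in \<open>auto simp: comb_parent_def\<close>)
  moreover have "comb_parent n p v = v - 1" using assms by (auto simp: comb_parent_def)
  ultimately have "int (transmission (comb n p) v) = int (transmission (comb n p) (v - 1)) + int n
      - 2 * int (card ({v..<n - 2} \<union> ?L))"
    using transmission_comb_branch[of v] assms by simp
  moreover have "card ({v..<n - 2} \<union> ?L) = card {v..<n - 2} + card ?L"
    using p_bound by (intro card_Un_disjoint) auto
  moreover have "card ?L = (if v \<le> p then 1 else 0) + (if v \<le> p + 2 then 1 else 0)"
    using p_bound by auto
  ultimately show ?thesis using assms p_bound by (simp add: of_nat_diff)
qed

lemma transmission_comb_pendant:
  "int (transmission (comb n p) (n - 2)) = int (transmission (comb n p) p) + int n - 2"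
  "int (transmission (comb n p) (n - 1)) = int (transmission (comb n p) (p + 2)) + int n - 2"
proof -
  have "branch n (comb_parent n p) (n - 2) {n - 2}" "branch n (comb_parent n p) (n - 1) {n - 1}"
    using p_bound unfolding branch_def comb_parent_def by auto
  moreover have "comb_parent n p (n - 2) = p" "comb_parent n p (n - 1) = p + 2"
    using p_bound by (auto simp: comb_parent_def)
  ultimately show
    "int (transmission (comb n p) (n - 2)) = int (transmission (comb n p) p) + int n - 2"
    "int (transmission (comb n p) (n - 1)) = int (transmission (comb n p) (p + 2)) + int n - 2"
    using transmission_comb_branch[of "n - 2" "{n - 2}"]
      transmission_comb_branch[of "n - 1" "{n - 1}"] p_bound
    by simp_all
qed

end

section \<open>The transmissions are distinct\<close>

text \<open>
  The transmission of \<open>x\<close> minus that of \<open>2 * k\<close>, in the tree with \<open>n = 4 * k + 1 + 2 * e\<close> and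
  \<open>p = 2 * k\<close>. The cases are the left arm, the vertex between the two branching points, the right
  arm, and the two attached leaves \<open>n - 2\<close> and \<open>n - 1\<close>.
\<close>

definition comb_offset :: "nat \<Rightarrow> nat \<Rightarrow> nat \<Rightarrow> int" where
  "comb_offset k e x =
    (if x \<le> 2 * k then (2 * int k - int x + int e)\<^sup>2 - int e
     else if x = 2 * k + 1 then 3 - 2 * int e
     else if x \<le> 4 * k + 2 * e - 2 then (int x - 2 * int k + 2 - int e)\<^sup>2 - 8 + 3 * int e
     else if x = 4 * k + 2 * e - 1 then 4 * int k + 2 * int e - 1
     else 4 * int k + 7 - 2 * int e)"

text \<open>
  Along the path both sides have the same increments, and the offset vanishes at \<open>2 * k\<close>; a leaf
  adds \<open>n - 2\<close> to the transmission of its neighbour.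
\<close>

lemma transmission_comb:
  assumes "n = 4 * k + 1 + 2 * e" "e = 0 \<and> 2 \<le> k \<or> e = 1 \<and> 1 \<le> k" "x < n"
  shows "int (transmission (comb n (2 * k)) x)
    = int (transmission (comb n (2 * k)) (2 * k)) + comb_offset k e x"
proof -
  let ?T = "\<lambda>x. int (transmission (comb n (2 * k)) x)"
  have bound: "2 * k + 5 \<le> n" using assms by auto
  have step: "?T (Suc v) - ?T v = comb_offset k e (Suc v) - comb_offset k e v"
    if "Suc v < n - 2" for v
  proof -
    consider "Suc v \<le> 2 * k" | "v = 2 * k" | "v = 2 * k + 1" | "2 * k + 2 \<le> v" by linarith
    then show ?thesis
      using transmission_comb_path[OF bound, of "Suc v"] that assms(1,2)
      by cases (auto simp: comb_offset_def power2_eq_square algebra_simps)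
  qed
  have path: "?T v - ?T 0 = comb_offset k e v - comb_offset k e 0" if "v < n - 2" for v
    using that
  proof (induct v)
    case (Suc v)
    then show ?case using step[of v] by simp
  qed simp
  have "comb_offset k e (2 * k) = 0" using assms(2) by (auto simp: comb_offset_def)
  with path[of "2 * k"] path bound have main: "?T v = ?T (2 * k) + comb_offset k e v"
    if "v < n - 2" for v using that by fastforce
  consider "x < n - 2" | "x = n - 2" | "x = n - 1" using assms(3) by linarith
  then show ?thesis
  proof cases
    case 1
    then show ?thesis by (rule main)
  next
    case 2
    then show ?thesis
      using transmission_comb_pendant(1)[OF bound] assms(1,2) by (auto simp: comb_offset_def)
  next
    case 3
    then show ?thesis
      using transmission_comb_pendant(2)[OF bound] main[of "2 * k + 2"] assms(1,2)
      by (auto simp: comb_offset_def)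
  qed
qed

lemma square_mod_4: "(z::int)\<^sup>2 mod 4 \<in> {0, 1}"
proof -
  have "z mod 4 \<in> {0, 1, 2, 3}" by auto
  then show ?thesis by (auto simp: power_mod[symmetric, of z])
qed

text \<open>
  Squares of nonnegative integers three or more apart differ by at least 9, so only gaps of one and
  two are left, and each determines the smaller number from \<open>c\<close>.
\<close>

lemma squares_with_gap_below_9:
  fixes a b c :: int
  assumes "b\<^sup>2 = a\<^sup>2 + c" "0 < c" "c < 9" "0 \<le> a" "0 \<le> b"
  shows "b = a + 1 \<and> c = 2 * a + 1 \<or> b = a + 2 \<and> c = 4 * a + 4"
proof -
  have "a\<^sup>2 < b\<^sup>2" using assms(1,2) by simp
  then have "a < b" using assms(5) power_less_imp_less_base by blast
  moreover have "b < a + 3"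
  proof (rule ccontr)
    assume "\<not> b < a + 3"
    then have "(a + 3)\<^sup>2 \<le> b\<^sup>2" using assms(4) by (intro power_mono) auto
    moreover have "(a + 3)\<^sup>2 = a\<^sup>2 + 6 * a + 9" by (simp add: power2_eq_square algebra_simps)
    ultimately show False using assms(1,3,4) by linarith
  qed
  ultimately have "b = a + 1 \<or> b = a + 2" by linarith
  then show ?thesis using assms(1) by (auto simp: power2_eq_square algebra_simps)
qed

context
  fixes k e :: nat
  assumes ke: "e = 0 \<and> 2 \<le> k \<or> e = 1 \<and> 1 \<le> k"
begin

lemma comb_offset_left:
  "x \<le> 2 * k \<Longrightarrow> comb_offset k e x = (2 * int k - int x + int e)\<^sup>2 - int e"
  by (simp add: comb_offset_def)

lemma comb_offset_right:
  "2 * k + 2 \<le> x \<Longrightarrow> x \<le> 4 * k + 2 * e - 2 \<Longrightarrow>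
    comb_offset k e x = (int x - 2 * int k + 2 - int e)\<^sup>2 - 8 + 3 * int e"
  by (simp add: comb_offset_def)

lemma comb_offset_special:
  "comb_offset k e (2 * k + 1) = 3 - 2 * int e"
  "comb_offset k e (4 * k + 2 * e - 1) = 4 * int k + 2 * int e - 1"
  "comb_offset k e (4 * k + 2 * e) = 4 * int k + 7 - 2 * int e"
  using ke by (auto simp: comb_offset_def)

lemma vertex_cases:
  assumes "x \<le> 4 * k + 2 * e"
  obtains (left) "x \<le> 2 * k" | (right) "2 * k + 2 \<le> x" "x \<le> 4 * k + 2 * e - 2"
    | (special) "x \<in> {2 * k + 1, 4 * k + 2 * e - 1, 4 * k + 2 * e}"
proof -
  have "x \<le> 2 * k \<or> x = 2 * k + 1 \<or> 2 * k + 2 \<le> x \<and> x \<le> 4 * k + 2 * e - 2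
      \<or> x = 4 * k + 2 * e - 1 \<or> x = 4 * k + 2 * e"
    using assms by linarith
  then show thesis using that by blast
qed

text \<open>
  On both arms the additive constant is congruent to \<open>- e\<close> modulo 4, so that adding \<open>e\<close> leaves a
  square; the three exceptional values stay off the residues of squares.
\<close>

lemma comb_offset_mod_4:
  assumes "x \<le> 4 * k + 2 * e"
  shows "(comb_offset k e x + int e) mod 4 \<in>
    (if x \<in> {2 * k + 1, 4 * k + 2 * e - 1, 4 * k + 2 * e} then {2, 3} else {0, 1})"
  using assms
proof (cases rule: vertex_cases)
  case left
  then show ?thesis
    using ke square_mod_4[of "2 * int k - int x + int e"] by (auto simp: comb_offset_left)
next
  case right
  have "(s - 8 + 3 * int e + int e) mod 4 = s mod 4" for s by presburger
  then show ?thesis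
    using right square_mod_4[of "int x - 2 * int k + 2 - int e"]
    by (auto simp: comb_offset_right)
next
  case special
  have "(3 - 2 * int e + int e) mod 4 \<in> {2, 3}"
    "(4 * int k + 2 * int e - 1 + int e) mod 4 \<in> {2, 3}"
    "(4 * int k + 7 - 2 * int e + int e) mod 4 \<in> {2, 3}"
    using ke by (auto; presburger)+
  then show ?thesis using special comb_offset_special by (simp only: insert_iff if_True) auto
qed

text \<open>
  Within an arm the squares are strictly monotone. Between the arms \<open>b\<^sup>2 - a\<^sup>2 = 8 - 4 * e\<close> would
  force \<open>b = 3 - e\<close>, but \<open>b \<ge> 4 - e\<close> on the right arm.
\<close>

lemma inj_on_comb_offset: "inj_on (comb_offset k e) {..4 * k + 2 * e}"
proof (rule linorder_inj_onI)
  fix x y :: nat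
  assume "x < y" and y_in: "y \<in> {..4 * k + 2 * e}"
  let ?special = "{2 * k + 1, 4 * k + 2 * e - 1, 4 * k + 2 * e}"
  have x: "x \<le> 4 * k + 2 * e" and y: "y \<le> 4 * k + 2 * e" using \<open>x < y\<close> y_in by auto
  show "comb_offset k e x \<noteq> comb_offset k e y"
  proof
    assume eq: "comb_offset k e x = comb_offset k e y"
    with comb_offset_mod_4[OF x] comb_offset_mod_4[OF y]
    have same: "x \<in> ?special \<longleftrightarrow> y \<in> ?special"
      by (simp split: if_splits) auto
    show False
    proof (cases "x \<in> ?special")
      case True
      moreover have "y \<in> ?special" using True same by blast
      moreover have "2 * k + 1 < 4 * k + 2 * e - 1" using ke by auto
      ultimately have "x = 2 * k + 1 \<and> y = 4 * k + 2 * e - 1 \<or> x = 2 * k + 1 \<and> y = 4 * k + 2 * e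
          \<or> x = 4 * k + 2 * e - 1 \<and> y = 4 * k + 2 * e"
        using \<open>x < y\<close> by (elim insertE emptyE; linarith)
      then show False
        using eq ke comb_offset_special by (elim disjE conjE) simp_all
    next
      case False
      from y show False
      proof (cases rule: vertex_cases)
        case left
        have "(2 * int k - int y + int e)\<^sup>2 < (2 * int k - int x + int e)\<^sup>2"
          using left \<open>x < y\<close> by (intro power_strict_mono) auto
        then show False
          using eq comb_offset_left[OF left] comb_offset_left[of x] left \<open>x < y\<close> by linarith
      next
        case right
        have "e \<le> 1" using ke by auto
        from x show False
        proof (cases rule: vertex_cases)
          case left
          define a b where "a = 2 * int k - int x + int e"
            and "b = int y - 2 * int k + 2 - int e"
          have "b\<^sup>2 = a\<^sup>2 + (8 - 4 * int e)"
            using eq unfolding comb_offset_left[OF left] comb_offset_right[OF right] a_def b_def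
            by linarith
          moreover have "0 \<le> a" "4 - int e \<le> b"
            using left right(1) unfolding a_def b_def by linarith+
          ultimately have "b = a + 1 \<and> 8 - 4 * int e = 2 * a + 1
              \<or> b = a + 2 \<and> 8 - 4 * int e = 4 * a + 4"
            using \<open>e \<le> 1\<close> by (intro squares_with_gap_below_9) linarith+
          then show False
          proof (elim disjE conjE)
            assume "8 - 4 * int e = 2 * a + 1"
            then show False by presburger
          next
            assume "b = a + 2" "8 - 4 * int e = 4 * a + 4"
            then show False using \<open>4 - int e \<le> b\<close> by linarith
          qed
        next
          case right_x: right
          have "(int x - 2 * int k + 2 - int e)\<^sup>2 < (int y - 2 * int k + 2 - int e)\<^sup>2"
            using right_x(1) \<open>x < y\<close> \<open>e \<le> 1\<close> by (intro power_strict_mono) auto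
          then show False
            using eq comb_offset_right[OF right] comb_offset_right[OF right_x] by linarith
        qed (use False in blast)
      qed (use False same in blast)
    qed
  qed
qed (rule linear)

end

theorem theorem3p2:
  fixes n :: nat
  assumes "n \<ge> 7" and "odd n"
  shows "\<exists>G :: nat pair_pre_digraph.
           chemical_tree G \<and> graph_order G = n \<and> transmission_irregular G"
proof -
  \<comment> \<open>\<open>n \<ge> 7\<close> leaves \<open>k \<ge> 2\<close> if \<open>n\<close> is 1 modulo 4 and \<open>k \<ge> 1\<close> if it is 3, as the right arm needs.\<close>
  define k e where "k = n div 4" and "e = n div 2 mod 2"
  have n: "n = 4 * k + 1 + 2 * e" and ke: "e = 0 \<and> 2 \<le> k \<or> e = 1 \<and> 1 \<le> k"
    using assms unfolding k_def e_def by presburger+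
  then have bound: "2 * k + 5 \<le> n" by auto
  let ?G = "comb n (2 * k)"
  have verts: "pverts ?G = {..<n}" by (simp add: comb_def)
  have "transmission ?G x \<noteq> transmission ?G y" if "x < y" "y < n" for x y
  proof -
    have "comb_offset k e x \<noteq> comb_offset k e y"
      using inj_on_contraD[OF inj_on_comb_offset[OF ke], of x y] that n by simp
    then show ?thesis
      using transmission_comb[OF n ke, of x] transmission_comb[OF n ke, of y] that by auto
  qed
  then have "transmission_irregular ?G"
    unfolding transmission_irregular_def verts by (metis lessThan_iff linorder_neqE_nat)
  then show ?thesis
    using chemical_tree_comb[OF bound] verts by (auto simp: graph_order_def)
qed

end
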